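(* For every integer $k\ge1$, $$E^{k(k-1)\cdots1}_{3\text{-}12}(x)=\begin{cases}e^{e^x}\displaystyle\int_0^x e^{-e^t}\sum_{n\ge k-1}\frac{t^n}{n!}\,dt,&\text{if }k\ge2,\\[2mm] e^{e^x-1},&\text{if }k=1.\end{cases}$$
   Context: A permutation $\pi=\pi_1\cdots\pi_n$ of $\{1,\dots,n\}$ contains the generalized pattern $3\text{-}12$ if there are indices $i<j<n$ such that $\pi_i\pi_j\pi_{j+1}$ is order-isomorphic to $312$; otherwise it avoids it. A permutation $\pi$ begins with a pattern $p=p_1\cdots p_k$ if $n\ge k$ and $\pi_1\cdots\pi_k$ is order-isomorphic to $p$; by convention, the empty permutation is also regarded as beginning with the pattern $1$ (the case $k=1$). $E^p_q(x)=\sum_{n\ge0}N^p_q(n)\frac{x^n}{n!}$, where $N^p_q(n)$ is the number of permutations of $\{1,\dots,n\}$ that avoid $q$ and begin with $p$. Identities are identities of power series in $x$. *)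

theory Defs
  imports
    "HOL-Computational_Algebra.Formal_Power_Series"
    "HOL-Combinatorics.Multiset_Permutations"
begin

unbundle fps_syntax

(* Permutations of {1..n} are written in one-line notation, i.e. as elements of
   permutations_of_set {1..n}; the entry pi_i is xs ! (i - 1). *)

definition order_isomorphic :: "nat list \<Rightarrow> nat list \<Rightarrow> bool" where
  "order_isomorphic xs ys \<longleftrightarrow> length xs = length ys \<and>
     (\<forall>i<length xs. \<forall>j<length xs. xs ! i < xs ! j \<longleftrightarrow> ys ! i < ys ! j)"

(* The entries playing the roles of 1 and 2 have to be adjacent. *)
definition contains_3_12 :: "nat list \<Rightarrow> bool" where
  "contains_3_12 xs \<longleftrightarrow>
     (\<exists>i j. i < j \<and> Suc j < length xs \<and> order_isomorphic [xs ! i, xs ! j, xs ! Suc j] [3, 1, 2])"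

(* The second disjunct is the convention that the empty permutation begins with 1. *)
definition begins_with :: "nat list \<Rightarrow> nat list \<Rightarrow> bool" where
  "begins_with xs p \<longleftrightarrow>
     (length p \<le> length xs \<and> order_isomorphic (take (length p) xs) p) \<or> (xs = [] \<and> p = [1])"

(* The pattern to be avoided is given by its containment predicate. *)
definition num_perms :: "nat list \<Rightarrow> (nat list \<Rightarrow> bool) \<Rightarrow> nat \<Rightarrow> nat" where
  "num_perms p contains_q n =
     card {xs \<in> permutations_of_set {1..n}. \<not> contains_q xs \<and> begins_with xs p}"

definition egf :: "nat list \<Rightarrow> (nat list \<Rightarrow> bool) \<Rightarrow> real fps" where
  "egf p contains_q = Abs_fps (\<lambda>n. real (num_perms p contains_q n) / fact n)"

(* exp (F(x)) for a power series F whose constant term c may be nonzero. As fps_compose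
   is only meaningful for an inner series without constant term, it is written as
   exp c * exp (F(x) - c). *)
definition fps_exp_of :: "real fps \<Rightarrow> real fps" where
  "fps_exp_of F = fps_const (exp (F $ 0)) * (fps_exp 1 oo (F - fps_const (F $ 0)))"

(* These two properties characterise exp (F(x)). *)
lemma fps_exp_of_nth_0: "fps_exp_of F $ 0 = exp (F $ 0)"
  by (simp add: fps_exp_of_def)

lemma fps_deriv_fps_exp_of: "fps_deriv (fps_exp_of F) = fps_deriv F * fps_exp_of F"
  by (simp add: fps_exp_of_def fps_compose_deriv mult_ac)

end

(* If a permutation s @ m # t of a set with maximum m avoids 3-12, then t is descending, and so
   s can be any avoider on any subset of the remaining entries. It begins with k(k-1)...1 exactly
   if s does, except that for empty s it is itself descending and only needs length k. This gives
   N(n+1) = sum_j (n choose j) N(j) + [2 <= k <= n+1], that is, E' = e^x E + S, which is solved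
   with the integrating factor exp(-e^x). *)

theory Submission
  imports Defs
begin

section \<open>Both pattern notions as inequalities between entries\<close>

lemma order_isomorphic_312_iff: "order_isomorphic [a, b, c] [3, 1, 2] \<longleftrightarrow> b < c \<and> c < a"
  by (auto simp: order_isomorphic_def less_Suc_eq numeral_3_eq_3)

lemma contains_3_12_iff:
  "contains_3_12 xs \<longleftrightarrow> (\<exists>i j. i < j \<and> Suc j < length xs \<and> xs ! j < xs ! Suc j \<and> xs ! Suc j < xs ! i)"
  by (simp only: contains_3_12_def order_isomorphic_312_iff)

lemma order_isomorphic_rev_upt_iff:
  "order_isomorphic xs (rev [1..<Suc k]) \<longleftrightarrow> length xs = k \<and> sorted_wrt (>) xs"
proof -
  have nth: "rev [1..<Suc k] ! i = k - i" if "i < k" for i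
    using that by (simp add: rev_nth del: upt_Suc One_nat_def)
  show ?thesis
  proof
    assume "order_isomorphic xs (rev [1..<Suc k])"
    then show "length xs = k \<and> sorted_wrt (>) xs"
      by (auto simp: order_isomorphic_def sorted_wrt_iff_nth_less nth simp del: upt_Suc One_nat_def)
  next
    assume xs: "length xs = k \<and> sorted_wrt (>) xs"
    have "xs ! i < xs ! j \<longleftrightarrow> k - i < k - j" if "i < k" "j < k" for i j
    proof (cases i j rule: linorder_cases)
      case less
      with xs that have "xs ! j < xs ! i"
        by (simp add: sorted_wrt_iff_nth_less)
      with less show ?thesis
        by simp
    next
      case greater
      with xs that have "xs ! i < xs ! j"
        by (simp add: sorted_wrt_iff_nth_less)
      with greater that show ?thesis
        by simp
    qed simp
    with xs show "order_isomorphic xs (rev [1..<Suc k])"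
      by (auto simp: order_isomorphic_def nth simp del: upt_Suc One_nat_def)
  qed
qed

text \<open>The last disjunct keeps the convention for the empty permutation, which makes the
  constant coefficient of the generating function 1 for \<open>k = 1\<close>.\<close>

definition begins_descending :: "nat \<Rightarrow> nat list \<Rightarrow> bool" where
  "begins_descending k xs \<longleftrightarrow>
     k \<le> length xs \<and> sorted_wrt (>) (take k xs) \<or> xs = [] \<and> k = 1"

lemma begins_with_rev_upt_iff:
  "begins_with xs (rev [1..<Suc k]) \<longleftrightarrow> begins_descending k xs"
proof -
  have "rev [1..<Suc k] = [1] \<longleftrightarrow> k = 1"
    by (cases k) auto
  then show ?thesis
    by (auto simp: begins_with_def begins_descending_def order_isomorphic_rev_upt_iff
        simp del: upt_Suc One_nat_def)
qed

section \<open>Splitting a permutation at its maximum\<close>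

lemma contains_3_12_append_Cons_iff:
  assumes "\<And>x. x \<in> set s \<Longrightarrow> x < m" "\<And>x. x \<in> set t \<Longrightarrow> x < m" "distinct t"
  shows "contains_3_12 (s @ m # t) \<longleftrightarrow> contains_3_12 s \<or> \<not> sorted_wrt (>) t"
proof
  assume "contains_3_12 (s @ m # t)"
  then obtain i j where ij: "i < j" "Suc j < length (s @ m # t)"
      "(s @ m # t) ! j < (s @ m # t) ! Suc j" "(s @ m # t) ! Suc j < (s @ m # t) ! i"
    by (auto simp: contains_3_12_iff)
  have le: "x \<le> m" if "x \<in> set (s @ m # t)" for x
    using that assms(1,2) by (auto simp: less_imp_le)
  \<comment> \<open>The maximum \<open>m\<close> cannot be one of the two adjacent entries: as the 2
    it would have a larger entry before it, as the 1 a larger entry after it. So the adjacent pair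
    lies within \<open>s\<close> or within \<open>t\<close>.\<close>
  have "Suc j \<noteq> length s"
  proof
    assume "Suc j = length s"
    then have "m < (s @ m # t) ! i"
      using ij(4) by (simp add: nth_append)
    moreover have "(s @ m # t) ! i \<in> set (s @ m # t)"
      using ij(1,2) by (intro nth_mem) simp
    ultimately show False
      using le by (meson not_le)
  qed
  moreover have "j \<noteq> length s"
  proof
    assume "j = length s"
    then have "m < (s @ m # t) ! Suc j"
      using ij(3) by (simp add: nth_append)
    then show False
      using le ij(2) by (meson not_le nth_mem)
  qed
  ultimately consider "Suc j < length s" | "length s < j"
    by linarith
  then show "contains_3_12 s \<or> \<not> sorted_wrt (>) t"
  proof cases
    case 1
    then show ?thesis
      using ij by (auto simp: contains_3_12_iff nth_append)
  next
    case 2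
    define l where "l = j - Suc (length s)"
    have j: "j = Suc (length s + l)"
      using 2 by (simp add: l_def)
    have "t ! l < t ! Suc l" "Suc l < length t"
      using ij(2,3) by (simp_all add: j nth_append)
    then show ?thesis
      by (metis lessI less_imp_not_less sorted_wrt_nth_less)
  qed
next
  assume "contains_3_12 s \<or> \<not> sorted_wrt (>) t"
  then show "contains_3_12 (s @ m # t)"
  proof
    assume "contains_3_12 s"
    then obtain i j where "i < j" "Suc j < length s" "s ! j < s ! Suc j" "s ! Suc j < s ! i"
      by (auto simp: contains_3_12_iff)
    then show ?thesis
      unfolding contains_3_12_iff
      by (intro exI[of _ i] exI[of _ j]) (auto simp: nth_append)
  next
    assume "\<not> sorted_wrt (>) t"
    \<comment> \<open>As \<open>>\<close> is transitive, a failure of descent shows at two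
      neighbours, and these can serve as the adjacent 1 and 2. The 3 is \<open>m\<close>, at
      position \<open>length s\<close>.\<close>
    then obtain l where l: "Suc l < length t" "\<not> t ! Suc l < t ! l"
      by (subst (asm) sorted_wrt_iff_nth_Suc_transp) (auto simp: transp_def)
    then have "t ! l < t ! Suc l"
      using assms(3) by (metis Suc_lessD linorder_neqE_nat n_not_Suc_n nth_eq_iff_index_eq)
    moreover have "t ! Suc l < m"
      using assms(2) l(1) by simp
    ultimately show ?thesis
      unfolding contains_3_12_iff using l(1)
      by (intro exI[of _ "length s"] exI[of _ "Suc (length s + l)"]) (auto simp: nth_append)
  qed
qed

text \<open>If \<open>s\<close> is nonempty and shorter than \<open>k\<close>, the prefix of length
  \<open>k\<close> contains the first entry of \<open>s\<close> and, behind it, the larger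
  \<open>m\<close>, so it does not descend. If \<open>s\<close> is empty, \<open>m # t\<close>
  descends as a whole and only its length matters.\<close>

lemma begins_descending_append_Cons_iff:
  assumes "\<And>x. x \<in> set s \<Longrightarrow> x < m" "\<And>x. x \<in> set t \<Longrightarrow> x < m" "sorted_wrt (>) t" "k \<ge> 1"
  shows "begins_descending k (s @ m # t) \<longleftrightarrow>
    begins_descending k s \<or> s = [] \<and> k \<le> Suc (length t)"
proof (cases "s = []")
  case True
  have "sorted_wrt (>) (take k (m # t))"
    using assms(2,3) by (intro sorted_wrt_take) simp
  with True assms(4) show ?thesis
    by (auto simp: begins_descending_def)
next
  case False
  show ?thesis
  proof (cases "k \<le> length s")
    case True
    with False show ?thesis
      by (simp add: begins_descending_def)
  next
    case k: False
    then obtain l where l: "k = Suc (length s + l)"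
      by (metis less_iff_Suc_add not_le)
    have "hd s < m"
      using assms(1) False by simp
    moreover have "hd s \<in> set s"
      using False by simp
    ultimately have "\<not> sorted_wrt (>) (take k (s @ m # t))"
      using less_imp_not_less by (auto simp: l sorted_wrt_append)
    with False k show ?thesis
      by (simp add: begins_descending_def)
  qed
qed

section \<open>Counting avoiders by recursion on the maximum\<close>

lemma sorted_wrt_greater_iff:
  fixes xs :: "'a::linorder list"
  assumes "finite A"
  shows "set xs = A \<and> sorted_wrt (>) xs \<longleftrightarrow> xs = rev (sorted_list_of_set A)"
proof -
  have "sorted_wrt (>) xs \<longleftrightarrow> sorted_wrt (<) (rev xs)"
    by (simp add: sorted_wrt_rev)
  moreover have "set xs = A \<and> sorted_wrt (<) (rev xs) \<longleftrightarrow> sorted_list_of_set A = rev xs"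
    using sorted_list_of_set_unique[OF assms, of "rev xs"]
    by (auto simp: strict_sorted_iff distinct_card)
  ultimately show ?thesis
    by (metis rev_swap)
qed

text \<open>The entries form an arbitrary set because the part before the maximum may use any subset
  of the smaller entries.\<close>

definition avoiders :: "nat \<Rightarrow> nat set \<Rightarrow> nat list set" where
  "avoiders k A = {xs \<in> permutations_of_set A. \<not> contains_3_12 xs \<and> begins_descending k xs}"

lemma num_perms_rev_upt: "num_perms (rev [1..<Suc k]) contains_3_12 n = card (avoiders k {1..n})"
  by (simp only: num_perms_def avoiders_def begins_with_rev_upt_iff)

lemma avoiders_empty: "k \<ge> 1 \<Longrightarrow> avoiders k {} = (if k = 1 then {[]} else {})"
  by (auto simp: avoiders_def begins_descending_def contains_3_12_iff)

text \<open>The part \<open>s\<close> before \<open>m\<close> determines the whole permutation,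
  since the other entries must follow in descending order. The extra summand is the fully descending
  permutation, where \<open>s\<close> is empty: for \<open>k = 1\<close> the sum already counts it
  by the convention on the empty permutation, for larger \<open>k\<close> it does not.\<close>

lemma card_avoiders_insert:
  assumes "finite A" "\<And>x. x \<in> A \<Longrightarrow> x < m" "k \<ge> 1"
  shows "card (avoiders k (insert m A)) =
    (\<Sum>B\<in>Pow A. card (avoiders k B)) + (if 2 \<le> k \<and> k \<le> Suc (card A) then 1 else 0)"
proof -
  \<comment> \<open>\<open>G B\<close> collects the admissible parts \<open>s\<close> with entry set
    \<open>B\<close>. It can differ from \<open>avoiders k B\<close> only for empty
    \<open>B\<close>.\<close>
  define G where "G B = {s \<in> permutations_of_set B. \<not> contains_3_12 s \<and>
    (begins_descending k s \<or> s = [] \<and> k \<le> Suc (card A))}" for B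
  define f where "f = (\<lambda>(B, s). s @ m # rev (sorted_list_of_set (A - B)))"
  have m: "m \<notin> A"
    using assms(2) by blast
  have split_iff: "s @ m # t \<in> avoiders k (insert m A) \<longleftrightarrow>
      set s \<subseteq> A \<and> s \<in> G (set s) \<and> t = rev (sorted_list_of_set (A - set s))" (is "?L \<longleftrightarrow> ?R") for s t
  proof
    assume L: ?L
    have st: "set s \<subseteq> A" "set t = A - set s" "distinct s" "distinct t"
      using L m by (auto simp: avoiders_def permutations_of_set_def)
    have lt: "\<And>x. x \<in> set s \<Longrightarrow> x < m" "\<And>x. x \<in> set t \<Longrightarrow> x < m"
      using st assms(2) by auto
    have "\<not> contains_3_12 s" and desc: "sorted_wrt (>) t"
      using L contains_3_12_append_Cons_iff[OF lt st(4)] by (auto simp: avoiders_def)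
    moreover have "begins_descending k s \<or> s = [] \<and> k \<le> Suc (length t)"
      using L lt desc assms(3) by (simp add: avoiders_def begins_descending_append_Cons_iff)
    \<comment> \<open>The length of \<open>t\<close> matters only for empty \<open>s\<close>, and
      then \<open>t\<close> arranges all of \<open>A\<close>. This lets \<open>G\<close> be defined
      without \<open>t\<close>.\<close>
    moreover have "length t = card A" if "s = []"
      using st that by (metis Diff_empty distinct_card empty_set)
    moreover have "t = rev (sorted_list_of_set (A - set s))"
      using st(2) desc assms(1) sorted_wrt_greater_iff[of "A - set s" t] by simp
    ultimately show ?R
      using st by (auto simp: G_def permutations_of_set_def)
  next
    assume R: ?R
    have desc: "sorted_wrt (>) t" and t: "set t = A - set s"
      using R assms(1) sorted_wrt_greater_iff[of "A - set s" t] by auto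
    have "distinct t"
      using R by simp
    have lt: "\<And>x. x \<in> set s \<Longrightarrow> x < m" "\<And>x. x \<in> set t \<Longrightarrow> x < m"
      using R t assms(2) by auto
    have "\<not> contains_3_12 (s @ m # t)"
      using R desc contains_3_12_append_Cons_iff[OF lt \<open>distinct t\<close>] by (simp add: G_def)
    moreover have "length t = card A" if "s = []"
      using t that \<open>distinct t\<close> by (metis Diff_empty distinct_card empty_set)
    then have "begins_descending k (s @ m # t)"
      using R begins_descending_append_Cons_iff[OF lt desc assms(3)] by (auto simp: G_def)
    ultimately show ?L
      using R m t \<open>distinct t\<close> by (auto simp: avoiders_def G_def permutations_of_set_def)
  qed
  have set_G: "set s = B" if "s \<in> G B" for s B
    using that by (simp add: G_def permutations_of_set_def)
  have "inj_on f (Sigma (Pow A) G)"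
  proof (rule inj_onI, clarify)
    fix B s C t
    assume *: "B \<subseteq> A" "C \<subseteq> A" "s \<in> G B" "t \<in> G C" "f (B, s) = f (C, t)"
    \<comment> \<open>As \<open>m\<close> occurs only once in the common word, it marks where the
      first part ends.\<close>
    then have "m \<notin> set s" "m \<notin> set t"
      using m set_G by blast+
    with *(5) m assms(1) have "s = t"
      by (simp add: f_def append_Cons_eq_iff)
    with * set_G show "B = C \<and> s = t"
      by blast
  qed
  moreover have "f ` Sigma (Pow A) G = avoiders k (insert m A)"
  proof (intro equalityI subsetI)
    fix xs assume "xs \<in> f ` Sigma (Pow A) G"
    then obtain B s where "B \<subseteq> A" "s \<in> G B" "xs = f (B, s)"
      by auto
    with set_G[of s B] show "xs \<in> avoiders k (insert m A)"
      by (simp add: f_def split_iff)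
  next
    fix xs assume xs: "xs \<in> avoiders k (insert m A)"
    then have "m \<in> set xs"
      by (auto simp: avoiders_def permutations_of_set_def)
    then obtain s t where "xs = s @ m # t"
      by (meson split_list)
    with xs have "xs = f (set s, s)" "(set s, s) \<in> Sigma (Pow A) G"
      by (auto simp: split_iff f_def)
    then show "xs \<in> f ` Sigma (Pow A) G"
      by blast
  qed
  ultimately have "card (avoiders k (insert m A)) = card (Sigma (Pow A) G)"
    by (metis card_image)
  also have "\<dots> = (\<Sum>B\<in>Pow A. card (G B))"
    using assms(1) by (intro card_SigmaI) (auto simp: G_def)
  also have "\<dots> = (\<Sum>B\<in>Pow A. card (avoiders k B) +
      (if B = {} then if 2 \<le> k \<and> k \<le> Suc (card A) then 1 else 0 else 0))"
  proof (intro sum.cong refl)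
    fix B
    show "card (G B) = card (avoiders k B) +
      (if B = {} then if 2 \<le> k \<and> k \<le> Suc (card A) then 1 else 0 else 0)"
    proof (cases "B = {}")
      case True
      have "G {} = (if k = 1 \<or> k \<le> Suc (card A) then {[]} else {})"
        by (auto simp: G_def begins_descending_def contains_3_12_iff)
      with True assms(3) show ?thesis
        by (auto simp: avoiders_empty)
    next
      case False
      then have "G B = avoiders k B"
        by (auto simp: G_def avoiders_def permutations_of_set_def)
      with False show ?thesis
        by simp
    qed
  qed
  also have "\<dots> = (\<Sum>B\<in>Pow A. card (avoiders k B)) + (if 2 \<le> k \<and> k \<le> Suc (card A) then 1 else 0)"
    using assms(1) by (simp add: sum.distrib)
  finally show ?thesis .
qed

lemma sum_Pow_card:
  fixes g :: "nat \<Rightarrow> nat"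
  assumes "finite A"
  shows "(\<Sum>B\<in>Pow A. g (card B)) = (\<Sum>j\<le>card A. (card A choose j) * g j)"
proof -
  have "(\<Sum>B\<in>Pow A. g (card B)) = (\<Sum>j\<le>card A. \<Sum>B\<in>{B \<in> Pow A. card B = j}. g (card B))"
    using assms by (intro sum.group[symmetric]) (auto intro: card_mono)
  also have "\<dots> = (\<Sum>j\<le>card A. (card A choose j) * g j)"
    using assms by (intro sum.cong) (auto simp: n_subsets)
  finally show ?thesis .
qed

text \<open>The recursion at the maximum sees a set only through its size, so strong induction on
  the size replaces relabelling the entries.\<close>

lemma card_avoiders_cong:
  assumes "finite A" "k \<ge> 1"
  shows "card (avoiders k A) = card (avoiders k {1..card A})"
  using assms(1)
proof (induction "card A" arbitrary: A rule: less_induct)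
  case less
  define g where "g j = card (avoiders k {1..j})" for j
  \<comment> \<open>Needed twice: for \<open>A\<close> without its maximum, and for
    \<open>{1..card B}\<close> with \<open>Suc (card B)\<close> as the new maximum. The subsets of
    \<open>B\<close> are smaller than \<open>A\<close>, so the induction hypothesis covers
    them.\<close>
  have rec: "card (avoiders k (insert m B)) =
      (\<Sum>j\<le>card B. (card B choose j) * g j) + (if 2 \<le> k \<and> k \<le> Suc (card B) then 1 else 0)"
    if "finite B" "card B < card A" "\<And>x. x \<in> B \<Longrightarrow> x < m" for B m
  proof -
    have "(\<Sum>C\<in>Pow B. card (avoiders k C)) = (\<Sum>C\<in>Pow B. g (card C))"
      unfolding g_def using that
      by (intro sum.cong refl less.hyps) (auto intro: finite_subset le_less_trans card_mono)
    also have "\<dots> = (\<Sum>j\<le>card B. (card B choose j) * g j)"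
      using that(1) by (rule sum_Pow_card)
    finally show ?thesis
      using that assms(2) by (simp add: card_avoiders_insert)
  qed
  show ?case
  proof (cases "A = {}")
    case False
    define m B where "m = Max A" and "B = A - {m}"
    have A: "A = insert m B" "finite B" "\<And>x. x \<in> B \<Longrightarrow> x < m" "m \<notin> B"
      using False less.prems by (auto simp: m_def B_def order.strict_iff_order insert_absorb)
    then have card: "card A = Suc (card B)"
      by simp
    then have "{1..card A} = insert (Suc (card B)) {1..card B}"
      by (simp add: atLeastAtMostSuc_conv)
    then show ?thesis
      using rec[of B m] rec[of "{1..card B}" "Suc (card B)"] A card by simp
  qed simp
qed

lemma card_avoiders_Suc:
  assumes "k \<ge> 1"
  shows "card (avoiders k {1..Suc n}) =
    (\<Sum>j\<le>n. (n choose j) * card (avoiders k {1..j})) + (if 2 \<le> k \<and> k \<le> Suc n then 1 else 0)"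
proof -
  have "(\<Sum>B\<in>Pow {1..n}. card (avoiders k B)) = (\<Sum>B\<in>Pow {1..n}. card (avoiders k {1..card B}))"
    using assms by (intro sum.cong refl card_avoiders_cong) (auto intro: finite_subset)
  then show ?thesis
    using assms card_avoiders_insert[of "{1..n}" "Suc n" k]
      sum_Pow_card[of "{1..n}" "\<lambda>j. card (avoiders k {1..j})"]
    by (simp add: atLeastAtMostSuc_conv)
qed

section \<open>The differential equation for the generating function and its solution\<close>

lemma fps_deriv_egf:
  assumes "k \<ge> 1"
  shows "fps_deriv (egf (rev [1..<Suc k]) contains_3_12) =
    fps_exp 1 * egf (rev [1..<Suc k]) contains_3_12 +
    Abs_fps (\<lambda>n. if 2 \<le> k \<and> k \<le> Suc n then 1 / fact n else 0)"
proof (rule fps_ext)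
  fix n
  define a where "a j = card (avoiders k {1..j})" for j
  have E: "egf (rev [1..<Suc k]) contains_3_12 = Abs_fps (\<lambda>n. real (a n) / fact n)"
    by (simp only: egf_def num_perms_rev_upt a_def)
  \<comment> \<open>The binomial convolution in the recursion, divided by n!, is a coefficient of
    e^x times the generating function.\<close>
  have "(\<Sum>j\<le>n. real (n choose j) * real (a j)) / fact n =
      (\<Sum>j=0..n. real (a j) / fact j * (1 / fact (n - j)))"
    unfolding sum_divide_distrib atMost_atLeast0
    by (intro sum.cong refl) (simp add: binomial_fact)
  moreover have "real (Suc n) * (real (a (Suc n)) / fact (Suc n)) = real (a (Suc n)) / fact n"
    by (simp del: of_nat_Suc)
  ultimately show "fps_deriv (egf (rev [1..<Suc k]) contains_3_12) $ n =
    (fps_exp 1 * egf (rev [1..<Suc k]) contains_3_12 +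
    Abs_fps (\<lambda>n. if 2 \<le> k \<and> k \<le> Suc n then 1 / fact n else 0)) $ n"
    unfolding E using card_avoiders_Suc[OF assms, of n, folded a_def]
    by (subst mult.commute) (simp add: fps_mult_nth add_divide_distrib del: of_nat_Suc fact_Suc)
qed

text \<open>By the product rule the derivatives of the two factors cancel, and the constant terms
  are reciprocal.\<close>

lemma fps_exp_of_mult_uminus: "fps_exp_of F * fps_exp_of (- F) = 1"
proof -
  have "fps_deriv (fps_exp_of F * fps_exp_of (- F)) = fps_deriv 1"
    by (simp add: fps_deriv_fps_exp_of algebra_simps)
  then show ?thesis
    unfolding fps_deriv_eq_iff
    by (simp add: fps_exp_of_nth_0 exp_minus)
qed

text \<open>With the integrating factor exp(-F), the product exp(-F) Y has derivative exp(-F) S. The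
  constant in the bracket is the constant term of this product.\<close>

lemma fps_linear_ode_solution:
  assumes "fps_deriv Y = fps_deriv F * Y + S"
  shows "Y = fps_exp_of F * (fps_const (exp (- F $ 0) * Y $ 0) + fps_integral0 (fps_exp_of (- F) * S))"
proof -
  have "fps_deriv (fps_exp_of (- F) * Y) =
      fps_deriv (fps_const (exp (- F $ 0) * Y $ 0) + fps_integral0 (fps_exp_of (- F) * S))"
    by (simp add: assms fps_deriv_fps_exp_of fps_deriv_fps_integral algebra_simps)
  then have "fps_exp_of (- F) * Y =
      fps_const (exp (- F $ 0) * Y $ 0) + fps_integral0 (fps_exp_of (- F) * S)"
    unfolding fps_deriv_eq_iff by (simp add: fps_exp_of_nth_0)
  then show ?thesis
    by (metis fps_exp_of_mult_uminus mult.assoc mult_1)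
qed

theorem proposition5:
  fixes k :: nat
  assumes "k \<ge> 1"
  shows "egf (rev [1..<Suc k]) contains_3_12 =
    (if k \<ge> 2
     then fps_exp_of (fps_exp 1) *
          fps_integral0 (fps_exp_of (- fps_exp 1) *
            Abs_fps (\<lambda>n. if n \<ge> k - 1 then 1 / fact n else 0))
     else fps_exp_of (fps_exp 1 - 1))"
proof -
  define E where "E = egf (rev [1..<Suc k]) contains_3_12"
  define S :: "real fps" where "S = Abs_fps (\<lambda>n. if 2 \<le> k \<and> k \<le> Suc n then 1 / fact n else 0)"
  have E0: "E $ 0 = (if k = 1 then 1 else 0)"
    using assms by (simp only: E_def egf_def num_perms_rev_upt) (simp add: avoiders_empty)
  \<comment> \<open>The derivative does not see \<open>c\<close>, so \<open>c\<close> can be chosen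
    to match each closed form. For \<open>k \<ge> 2\<close>, \<open>c = 0\<close> gives the factor
    e^(e^x), and \<open>E $ 0 = 0\<close> leaves only the integral. For \<open>k = 1\<close>,
    \<open>S\<close> vanishes, and \<open>c = 1\<close> makes the exponent start at 0, so that
    \<open>E $ 0 = 1\<close> leaves exactly e^(e^x - 1).\<close>
  have ode: "fps_deriv E = fps_deriv (fps_exp 1 - fps_const c) * E + S" for c
    using fps_deriv_egf[OF assms] by (simp add: E_def S_def)
  have "E = (if k \<ge> 2 then fps_exp_of (fps_exp 1) * fps_integral0 (fps_exp_of (- fps_exp 1) *
            Abs_fps (\<lambda>n. if n \<ge> k - 1 then 1 / fact n else 0)) else fps_exp_of (fps_exp 1 - 1))"
  proof (cases "k \<ge> 2")
    case True
    then have "S = Abs_fps (\<lambda>n. if n \<ge> k - 1 then 1 / fact n else 0)"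
      by (auto simp: S_def fps_eq_iff)
    with True E0 fps_linear_ode_solution[OF ode[of 0]] show ?thesis
      by simp
  next
    case False
    then have "k = 1" "S = 0"
      using assms by (auto simp: S_def fps_eq_iff)
    with E0 fps_linear_ode_solution[OF ode[of 1]] show ?thesis
      by (simp add: fps_integral0_zero)
  qed
  then show ?thesis
    unfolding E_def .
qed

end
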